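(* Let $A$ be a finite alphabet, $F:A^{\mathbb{Z}}\to A^{\mathbb{Z}}$ a one-dimensional cellular automaton of radius $r$, and $\mu$ a bi-invariant probability measure on $A^{\mathbb{Z}}$ (invariant under $F$ and under the shift $\sigma$). Then $$h_\mu(A^{\mathbb{Z}},F)\le 2r\cdot h_\mu(A^{\mathbb{Z}},\sigma).$$
   Context: $\sigma$ is the shift on $A^{\mathbb{Z}}$, $\sigma(x)_i=x_{i+1}$. A one-dimensional cellular automaton of radius $r$ is a map $F:A^{\mathbb{Z}}\to A^{\mathbb{Z}}$ for which there is $f:A^{2r+1}\to A$ with $F(x)_i=f(x_{i-r},\dots,x_{i+r})$ for all $i\in\mathbb{Z}$. $h_\mu(A^{\mathbb{Z}},F)$ and $h_\mu(A^{\mathbb{Z}},\sigma)$ are the usual measure-theoretic (Kolmogorov–Sinai) entropies. *)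

theory Defs
  imports "HOL-Probability.Probability"
begin

section \<open>Kolmogorov--Sinai entropy\<close>

definition measure_preserving :: "'b measure \<Rightarrow> ('b \<Rightarrow> 'b) \<Rightarrow> bool" where
  "measure_preserving M T \<longleftrightarrow> T \<in> M \<rightarrow>\<^sub>M M \<and> distr M M T = M"

definition finite_measurable_partition :: "'b measure \<Rightarrow> 'b set set \<Rightarrow> bool" where
  "finite_measurable_partition M P \<longleftrightarrow> finite P \<and> P \<subseteq> sets M \<and> partition_on (space M) P"

text \<open>Blocks of measure zero contribute \<open>0\<close>, in accordance with the convention
  \<open>0 log 0 = 0\<close>.\<close>

definition partition_entropy :: "'b measure \<Rightarrow> 'b set set \<Rightarrow> real" where
  "partition_entropy M P = - (\<Sum>p\<in>P. measure M p * ln (measure M p))"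

text \<open>Empty preimages are discarded because \<^const>\<open>partition_on\<close> does not admit empty blocks.\<close>

definition preimage_partition :: "'b measure \<Rightarrow> ('b \<Rightarrow> 'b) \<Rightarrow> 'b set set \<Rightarrow> 'b set set" where
  "preimage_partition M T P = (\<lambda>p. T -` p \<inter> space M) ` P - {{}}"

text \<open>The join of the preimages of \<open>P\<close> under \<open>T ^^ k\<close> for \<open>k < n\<close>. Preimage partitions that coincide
  for different \<open>k\<close> are collected only once, which does not affect the join.\<close>

definition iterated_partition :: "'b measure \<Rightarrow> ('b \<Rightarrow> 'b) \<Rightarrow> 'b set set \<Rightarrow> nat \<Rightarrow> 'b set set" where
  "iterated_partition M T P n = common_refinement ((\<lambda>k. preimage_partition M (T ^^ k) P) ` {..<n})"

definition entropy_wrt_partition :: "'b measure \<Rightarrow> ('b \<Rightarrow> 'b) \<Rightarrow> 'b set set \<Rightarrow> real" where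
  "entropy_wrt_partition M T P = lim (\<lambda>n. partition_entropy M (iterated_partition M T P n) / real n)"

text \<open>The supremum is taken in \<^typ>\<open>ereal\<close> because the entropy of a general system may be infinite.\<close>

definition ks_entropy :: "'b measure \<Rightarrow> ('b \<Rightarrow> 'b) \<Rightarrow> ereal" where
  "ks_entropy M T = (SUP P\<in>{P. finite_measurable_partition M P}. ereal (entropy_wrt_partition M T P))"


section \<open>Cellular automata\<close>

text \<open>As the index set is countable and the alphabet is finite, the product sigma-algebra is the
  Borel sigma-algebra of the product topology.\<close>

definition config_space :: "(int \<Rightarrow> 'a::finite) measure" where
  "config_space = (\<Pi>\<^sub>M i\<in>UNIV. count_space UNIV)"

definition config_shift :: "(int \<Rightarrow> 'a) \<Rightarrow> int \<Rightarrow> 'a" where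
  "config_shift x = (\<lambda>i. x (i + 1))"

text \<open>The local rule is only ever applied to words of length \<open>2 r + 1\<close>.\<close>

definition cellular_automaton :: "nat \<Rightarrow> ((int \<Rightarrow> 'a) \<Rightarrow> int \<Rightarrow> 'a) \<Rightarrow> bool" where
  "cellular_automaton r F \<longleftrightarrow>
    (\<exists>f :: 'a list \<Rightarrow> 'a. \<forall>x i. F x i = f (map x [i - int r..i + int r]))"

end

(* Approximate each block of a partition P by a cylinder set on the coordinates [-m, m]. The
   P-itinerary of length n under F is determined by the coordinates in [-(m + r n), m + r n] together
   with, for every time k < n and every block p, the bit telling whether F^k x lies in the small
   symmetric difference of p and its cylinder. By subadditivity and invariance the entropy of the
   itinerary is at most H(window of length 2(m + r n) + 1) + n e; divide by n and let n tend to
   infinity. *)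
theory Submission
  imports Defs "HOL-Real_Asymp.Real_Asymp"
begin

section \<open>Entropy of simple functions\<close>

text \<open>The obstacle is that blocks are arbitrary measurable sets, so no finite set of
  coordinates decides which block \<open>(F ^^ k) x\<close> visits. A cylinder is decided by
  finitely many coordinates, and locality widens that set by \<open>r\<close> on either side at each
  step, hence by \<open>2 * r\<close> cells per unit of time: this growth rate is the constant of
  the inequality. The offset \<open>m\<close> is fixed by the partition and \<open>e\<close> before
  \<open>n\<close> grows, so it leaves no trace in the limit. There are \<open>n\<close> error bits
  per block, but invariance under \<open>F\<close> gives each of them the law it has at time 0,
  which keeps their total cost linear in \<open>n\<close> with slope at most \<open>e\<close>. Shift
  invariance turns the window into a word starting at 0, whose entropy per letter tends to the shift
  entropy of the partition by the letter at 0.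

  Partitions are handled through maps constant on their blocks: joins become tuples, refinement
  becomes functional dependence, and the chain rule and data processing for simple functions
  apply.\<close>

definition obs_entropy :: "'b measure \<Rightarrow> ('b \<Rightarrow> 'c) \<Rightarrow> real" where
  "obs_entropy M X = - (\<Sum>v\<in>X ` space M. measure M (X -` {v} \<inter> space M) * ln (measure M (X -` {v} \<inter> space M)))"

text \<open>Restricting to \<open>I\<close> fixes the values elsewhere, so equality of tuples is
  exactly agreement on \<open>I\<close>.\<close>

definition joint :: "'i set \<Rightarrow> ('i \<Rightarrow> 'b \<Rightarrow> 'c) \<Rightarrow> 'b \<Rightarrow> 'i \<Rightarrow> 'c" where
  "joint I X x = restrict (\<lambda>i. X i x) I"

lemma joint_eq_iff: "joint I X x = joint I X y \<longleftrightarrow> (\<forall>i\<in>I. X i x = X i y)"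
  unfolding joint_def restrict_def fun_eq_iff by (rule iffI) (auto split: if_splits)

lemma simple_function_joint:
  assumes "finite I" "\<And>i. i \<in> I \<Longrightarrow> simple_function M (X i)"
  shows "simple_function M (joint I X)"
  using assms
proof (induction I rule: finite_induct)
  case empty
  then show ?case by (simp add: joint_def)
next
  case (insert i I)
  have "joint (insert i I) X = (\<lambda>(a, f). f(i := a)) \<circ> (\<lambda>x. (X i x, joint I X x))"
    using insert.hyps by (auto simp: joint_def fun_eq_iff)
  moreover have "simple_function M ((\<lambda>(a, f). f(i := a)) \<circ> (\<lambda>x. (X i x, joint I X x)))"
    using insert by (intro simple_function_compose simple_function_Pair) auto
  ultimately show ?case by (simp only:)
qed

lemma obs_entropy_cong:
  assumes "\<And>x. x \<in> space M \<Longrightarrow> X x = Y x"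
  shows "obs_entropy M X = obs_entropy M Y"
proof -
  have "X ` space M = Y ` space M" using assms by auto
  moreover have "X -` {v} \<inter> space M = Y -` {v} \<inter> space M" for v using assms by auto
  ultimately show ?thesis unfolding obs_entropy_def by simp
qed

lemma obs_entropy_superset:
  assumes "finite A" "X ` space M \<subseteq> A"
  shows "obs_entropy M X = - (\<Sum>v\<in>A. measure M (X -` {v} \<inter> space M) * ln (measure M (X -` {v} \<inter> space M)))"
proof -
  have "measure M (X -` {v} \<inter> space M) = 0" if "v \<notin> X ` space M" for v
  proof -
    have "X -` {v} \<inter> space M = {}" using that by auto
    then show ?thesis by simp
  qed
  then show ?thesis
    unfolding obs_entropy_def using assms by (auto intro!: sum.mono_neutral_left)
qed

context prob_space
begin

text \<open>Base \<open>exp 1\<close> makes the logarithm natural; this is the bridge to the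
  information theory of simple functions.\<close>

lemma obs_entropy_eq_entropy:
  assumes "simple_function M X"
  shows "obs_entropy M X = entropy (exp 1) (count_space (X ` space M)) X"
proof -
  interpret information_space M "exp 1" by unfold_locales simp
  show ?thesis
    using entropy_simple_distributed[OF simple_distributedI[OF assms measure_nonneg refl]]
    by (simp add: obs_entropy_def log_def)
qed

lemma obs_entropy_nonneg: "0 \<le> obs_entropy M X"
proof -
  have "measure M B * ln (measure M B) \<le> 0" for B
    by (cases "measure M B = 0")
       (auto intro!: mult_nonneg_nonpos simp: ln_le_zero_iff zero_less_measure_iff)
  then show ?thesis unfolding obs_entropy_def by (simp add: sum_nonpos)
qed

text \<open>On the space \<open>Y\<close> is a function of \<open>X\<close>, and data processing
  cannot raise entropy. All comparisons below between maps that determine one another go through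
  this form, in which the values themselves are irrelevant.\<close>

lemma obs_entropy_mono:
  assumes "simple_function M X"
    and "\<And>x y. x \<in> space M \<Longrightarrow> y \<in> space M \<Longrightarrow> X x = X y \<Longrightarrow> Y x = Y y"
  shows "obs_entropy M Y \<le> obs_entropy M X"
proof -
  interpret information_space M "exp 1" by unfold_locales simp
  \<comment> \<open>\<open>f v\<close> evaluates \<open>Y\<close> at an arbitrary point of the fibre
    over \<open>v\<close>; the second assumption makes the choice immaterial.\<close>
  define f where "f v = Y (SOME x. x \<in> space M \<and> X x = v)" for v
  have "Y x = (f \<circ> X) x" if "x \<in> space M" for x
    unfolding f_def comp_def using that
    by (intro assms(2)) (metis (mono_tags, lifting) someI_ex)+
  then have "obs_entropy M Y = obs_entropy M (f \<circ> X)" by (rule obs_entropy_cong)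
  also have "\<dots> \<le> obs_entropy M X"
    using entropy_data_processing[OF assms(1), of f] assms(1)
    by (simp add: obs_entropy_eq_entropy simple_function_compose)
  finally show ?thesis .
qed

text \<open>The chain rule writes the left side as the entropy of \<open>X\<close> plus the
  conditional entropy of \<open>Y\<close> given \<open>X\<close>, and conditioning does not increase
  entropy.\<close>

lemma obs_entropy_Pair:
  assumes "simple_function M X" "simple_function M Y"
  shows "obs_entropy M (\<lambda>x. (X x, Y x)) \<le> obs_entropy M X + obs_entropy M Y"
proof -
  interpret information_space M "exp 1" by unfold_locales simp
  show ?thesis
    using entropy_chain_rule[OF assms] conditional_entropy_less_eq_entropy[OF assms(2,1)] assms
    by (simp add: obs_entropy_eq_entropy simple_function_Pair)
qed

lemma obs_entropy_joint:
  assumes "finite I" "\<And>i. i \<in> I \<Longrightarrow> simple_function M (X i)"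
  shows "obs_entropy M (joint I X) \<le> (\<Sum>i\<in>I. obs_entropy M (X i))"
  using assms
proof (induction I rule: finite_induct)
  case empty
  \<comment> \<open>The empty tuple is constant, so its entropy is
    \<open>- (1 * ln 1) = 0\<close>.\<close>
  have "joint {} X = (\<lambda>x. (\<lambda>_. undefined))" by (auto simp: joint_def fun_eq_iff)
  moreover have "space M \<noteq> {}" by (rule not_empty)
  then have "(\<lambda>_. (\<lambda>_. undefined)) -` {v} \<inter> space M = (if v = (\<lambda>_. undefined) then space M else {})"
    for v :: "'i \<Rightarrow> 'z" by auto
  ultimately show ?case
    using not_empty by (auto simp: obs_entropy_def prob_space image_constant_conv)
next
  case (insert i I)
  have "obs_entropy M (joint (insert i I) X) \<le> obs_entropy M (\<lambda>x. (X i x, joint I X x))"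
    using insert by (intro obs_entropy_mono simple_function_Pair simple_function_joint)
      (auto simp: joint_eq_iff)
  also have "\<dots> \<le> obs_entropy M (X i) + obs_entropy M (joint I X)"
    using insert by (intro obs_entropy_Pair simple_function_joint) auto
  finally show ?case using insert by simp
qed

text \<open>The entropy of a bit is the binary entropy function of its probability, which tends to 0
  at 0 from the right.\<close>

lemma obs_entropy_indicator_small:
  assumes "e > 0"
  obtains d where "d > 0" "\<And>D. D \<in> sets M \<Longrightarrow> measure M D < d \<Longrightarrow> obs_entropy M (\<lambda>x. x \<in> D) \<le> e"
proof -
  define \<phi> :: "real \<Rightarrow> real" where "\<phi> t = - (t * ln t + (1 - t) * ln (1 - t))" for t
  have "(\<phi> \<longlongrightarrow> 0) (at_right 0)" unfolding \<phi>_def by real_asymp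
  then have "eventually (\<lambda>t. \<phi> t < e) (at_right 0)" using assms by (rule order_tendstoD)
  then obtain d where d: "d > 0" "\<And>t. 0 < t \<Longrightarrow> t < d \<Longrightarrow> \<phi> t < e"
    unfolding eventually_at_right_field by auto
  show ?thesis
  proof (rule that[OF d(1)])
    fix D assume D: "D \<in> sets M" "measure M D < d"
    have "(\<lambda>x. x \<in> D) -` {True} \<inter> space M = D" "(\<lambda>x. x \<in> D) -` {False} \<inter> space M = space M - D"
      using sets.sets_into_space[OF D(1)] by auto
    then have "obs_entropy M (\<lambda>x. x \<in> D) = \<phi> (measure M D)"
      using obs_entropy_superset[of "UNIV :: bool set" "\<lambda>x. x \<in> D" M] D(1)
      by (simp add: UNIV_bool \<phi>_def prob_compl subset_eq)
    \<comment> \<open>The limit only speaks of positive arguments; a null set is treated apart,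
      where both terms of \<open>\<phi> 0\<close> vanish.\<close>
    also have "\<dots> \<le> e"
      using d(2)[of "measure M D"] D assms measure_nonneg[of M D]
      by (cases "measure M D = 0") (auto simp: \<phi>_def less_le)
    finally show "obs_entropy M (\<lambda>x. x \<in> D) \<le> e" .
  qed
qed

end

section \<open>Invariance of entropy under measure-preserving maps\<close>

lemma measure_preserving_funpow:
  assumes "measure_preserving M T"
  shows "measure_preserving M (T ^^ k)"
proof (induction k)
  case 0
  have "distr M M id = M" by (rule measure_eqI) (auto simp: emeasure_distr sets.sets_into_space id_def Int_absorb2)
  then show ?case by (simp add: measure_preserving_def)
next
  case (Suc k)
  then have [measurable]: "T \<in> M \<rightarrow>\<^sub>M M" "T ^^ k \<in> M \<rightarrow>\<^sub>M M"
    and d: "distr M M T = M" "distr M M (T ^^ k) = M"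
    using assms by (auto simp: measure_preserving_def)
  have "distr M M (T \<circ> T ^^ k) = distr (distr M M (T ^^ k)) M T"
    by (intro distr_distr[symmetric]) auto
  then have "distr M M (T ^^ Suc k) = M" using d by (simp only: funpow.simps)
  moreover have "T ^^ Suc k \<in> M \<rightarrow>\<^sub>M M" unfolding funpow.simps comp_def by measurable
  ultimately show ?case by (simp only: measure_preserving_def simp_thms)
qed

lemma simple_function_comp_preserving:
  assumes "measure_preserving M T" "simple_function M X"
  shows "simple_function M (X \<circ> T)"
proof -
  have T: "T \<in> M \<rightarrow>\<^sub>M M" using assms(1) by (simp add: measure_preserving_def)
  have "(X \<circ> T) ` space M \<subseteq> X ` space M" using measurable_space[OF T] by auto
  then have "finite ((X \<circ> T) ` space M)"
    using simple_functionD(1)[OF assms(2)] by (rule finite_subset)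
  moreover have "(X \<circ> T) -` {v} \<inter> space M \<in> sets M" for v
  proof -
    have "(X \<circ> T) -` {v} \<inter> space M = T -` (X -` {v} \<inter> space M) \<inter> space M"
      using measurable_space[OF T] by auto
    then show ?thesis using measurable_sets[OF T simple_functionD(2)[OF assms(2)]] by metis
  qed
  ultimately show ?thesis by (simp add: simple_function_def)
qed

lemma obs_entropy_comp_preserving:
  assumes "measure_preserving M T" "simple_function M X"
  shows "obs_entropy M (X \<circ> T) = obs_entropy M X"
proof -
  have T: "T \<in> M \<rightarrow>\<^sub>M M" and d: "distr M M T = M"
    using assms(1) by (auto simp: measure_preserving_def)
  have *: "measure M ((X \<circ> T) -` {v} \<inter> space M) = measure M (X -` {v} \<inter> space M)" for v
  proof -
    have "(X \<circ> T) -` {v} \<inter> space M = T -` (X -` {v} \<inter> space M) \<inter> space M"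
      using measurable_space[OF T] by auto
    also have "measure M \<dots> = measure (distr M M T) (X -` {v} \<inter> space M)"
      using assms(2) by (intro measure_distr[symmetric] T) (simp add: simple_functionD)
    finally show ?thesis by (simp add: d)
  qed
  \<comment> \<open>\<open>T\<close> may miss some fibres of \<open>X\<close>, so the sum is taken
    over all values of \<open>X\<close>; values that \<open>X \<circ> T\<close> omits contribute
    0.\<close>
  have "obs_entropy M (X \<circ> T) = - (\<Sum>v\<in>X ` space M.
      measure M ((X \<circ> T) -` {v} \<inter> space M) * ln (measure M ((X \<circ> T) -` {v} \<inter> space M)))"
    using assms(2) measurable_space[OF T]
    by (intro obs_entropy_superset) (auto simp: simple_function_def)
  then show ?thesis unfolding * obs_entropy_def .
qed

section \<open>Itineraries and the entropy of a transformation\<close>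

text \<open>Division with remainder turns subadditivity into
  \<open>u n \<le> (n div m) * u m + u (n mod m)\<close>. Hence the quotients eventually fall below
  any number exceeding \<open>u m / m\<close>, and they converge to their infimum.\<close>

lemma fekete_limit:
  fixes u :: "nat \<Rightarrow> real"
  assumes nonneg: "\<And>n. 0 \<le> u n" and sub: "\<And>m n. u (m + n) \<le> u m + u n"
  shows "convergent (\<lambda>n. u n / real n)"
proof -
  \<comment> \<open>Starting at 1 excludes the quotient at 0, which is 0 by the convention for
    division and would pull the infimum down to 0.\<close>
  define S where "S = (\<lambda>n. u n / real n) ` {1..}"
  define L where "L = Inf S"
  have bdd: "bdd_below S" unfolding S_def by (rule bdd_belowI[of _ 0]) (auto simp: nonneg)
  have lower: "L \<le> u n / real n" if "n \<ge> 1" for n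
    unfolding L_def using bdd that by (intro cInf_lower) (auto simp: S_def)
  have mult: "u (q * m + s) \<le> real q * u m + u s" for q m s
  proof (induction q)
    case (Suc q)
    have "u (Suc q * m + s) \<le> u m + u (q * m + s)" using sub[of m "q * m + s"] by (simp add: add.assoc)
    with Suc show ?case by (simp add: algebra_simps)
  qed simp
  have "(\<lambda>n. u n / real n) \<longlonglongrightarrow> L"
  proof (rule order_tendstoI)
    fix a assume "a < L"
    then show "eventually (\<lambda>n. a < u n / real n) sequentially"
      using lower by (intro eventually_sequentiallyI[of 1]) (auto intro: less_le_trans)
  next
    fix a assume "L < a"
    then obtain m where m: "m \<ge> 1" "u m / real m < a"
      unfolding L_def using bdd cInf_less_iff[of S a] by (auto simp: S_def)
    \<comment> \<open>\<open>K\<close> bounds \<open>u (n mod m)\<close> for all \<open>n\<close> at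
      once, so the remainder disappears after division by \<open>n\<close>.\<close>
    define K where "K = (\<Sum>s<m. u s)"
    have "(\<lambda>n. K / real n) \<longlonglongrightarrow> 0" by real_asymp
    then have "eventually (\<lambda>n. K / real n < a - u m / real m) sequentially"
      using m by (intro order_tendstoD(2)) auto
    then show "eventually (\<lambda>n. u n / real n < a) sequentially"
      using eventually_gt_at_top[of 0]
    proof eventually_elim
      case (elim n)
      have "u n \<le> real (n div m) * u m + u (n mod m)"
        using mult[of "n div m" m "n mod m"] by simp
      also have "u (n mod m) \<le> K"
        unfolding K_def using m nonneg by (intro member_le_sum) auto
      also have "real (n div m) * u m \<le> (real n / real m) * u m"
        by (intro mult_right_mono nonneg of_nat_div_le_of_nat)
      finally have "u n / real n \<le> ((real n / real m) * u m + K) / real n"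
        by (simp add: divide_right_mono)
      also have "\<dots> = u m / real m + K / real n"
        using elim m by (simp add: field_simps)
      finally show ?case using elim by simp
    qed
  qed
  then show ?thesis by (auto simp: convergent_def)
qed

definition itinerary :: "('b \<Rightarrow> 'b) \<Rightarrow> ('b \<Rightarrow> 'c) \<Rightarrow> nat \<Rightarrow> 'b \<Rightarrow> nat \<Rightarrow> 'c" where
  "itinerary T X n = joint {..<n} (\<lambda>k. X \<circ> T ^^ k)"

lemma itinerary_eq_iff: "itinerary T X n x = itinerary T X n y \<longleftrightarrow> (\<forall>k<n. X ((T ^^ k) x) = X ((T ^^ k) y))"
  by (auto simp: itinerary_def joint_eq_iff)

lemma simple_function_itinerary:
  assumes "measure_preserving M T" "simple_function M X"
  shows "simple_function M (itinerary T X n)"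
  unfolding itinerary_def using assms
  by (intro simple_function_joint simple_function_comp_preserving measure_preserving_funpow) auto

text \<open>The first \<open>m\<close> labels together with the itinerary of length \<open>n\<close>
  started at \<open>(T ^^ m) x\<close> give the itinerary of length \<open>m + n\<close>; by
  invariance the second piece has the entropy of an unshifted one, so Fekete's lemma applies.
  Convergence makes the \<open>lim\<close> in the definition of entropy a genuine limit.\<close>

lemma (in prob_space) convergent_obs_entropy_itinerary:
  assumes T: "measure_preserving M T" and X: "simple_function M X"
  shows "convergent (\<lambda>n. obs_entropy M (itinerary T X n) / real n)"
proof (rule fekete_limit)
  fix m n
  let ?Y = "itinerary T X"
  note sf = simple_function_itinerary[OF T X]
  note Tm = measure_preserving_funpow[OF T, of m]
  have split: "?Y (m + n) x = ?Y (m + n) y"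
    if 1: "?Y m x = ?Y m y" and 2: "?Y n ((T ^^ m) x) = ?Y n ((T ^^ m) y)" for x y
    unfolding itinerary_eq_iff
  proof (intro allI impI)
    fix k assume k: "k < m + n"
    show "X ((T ^^ k) x) = X ((T ^^ k) y)"
    proof (cases "k < m")
      case True
      then show ?thesis using 1 unfolding itinerary_eq_iff by blast
    next
      case False
      then have "k - m < n" "T ^^ k = T ^^ (k - m) \<circ> T ^^ m"
        using k by (auto simp flip: funpow_add)
      with 2 show ?thesis unfolding itinerary_eq_iff by (metis comp_apply)
    qed
  qed
  have "obs_entropy M (?Y (m + n)) \<le> obs_entropy M (\<lambda>x. (?Y m x, (?Y n \<circ> T ^^ m) x))"
  proof (rule obs_entropy_mono)
    show "simple_function M (\<lambda>x. (?Y m x, (?Y n \<circ> T ^^ m) x))"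
      by (intro simple_function_Pair sf simple_function_comp_preserving[OF Tm])
    fix x y assume "(?Y m x, (?Y n \<circ> T ^^ m) x) = (?Y m y, (?Y n \<circ> T ^^ m) y)"
    then show "?Y (m + n) x = ?Y (m + n) y" by (intro split) auto
  qed
  also have "\<dots> \<le> obs_entropy M (?Y m) + obs_entropy M (?Y n \<circ> T ^^ m)"
    by (rule obs_entropy_Pair[OF sf simple_function_comp_preserving[OF Tm sf]])
  finally show "obs_entropy M (?Y (m + n)) \<le> obs_entropy M (?Y m) + obs_entropy M (?Y n)"
    by (simp add: obs_entropy_comp_preserving[OF Tm sf])
qed (rule obs_entropy_nonneg)

section \<open>Partitions as fibres of label maps\<close>

lemma partition_entropy_eq_obs_entropy:
  assumes Q: "partition_on (space M) Q"
    and X: "\<And>x y. x \<in> space M \<Longrightarrow> y \<in> space M \<Longrightarrow> X x = X y \<longleftrightarrow> (\<forall>q\<in>Q. x \<in> q \<longleftrightarrow> y \<in> q)"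
  shows "partition_entropy M Q = obs_entropy M X"
proof -
  let ?f = "\<lambda>v. X -` {v} \<inter> space M"
  \<comment> \<open>The fibres of \<open>X\<close> on the space are exactly the blocks, because
    disjointness makes sharing one block the same as agreeing on all of them. Both entropies then
    sum the same terms.\<close>
  have fib: "?f (X x) = q" if "q \<in> Q" "x \<in> q" for q x
  proof -
    have sp: "x \<in> space M" using that Q by (auto simp: partition_on_def)
    have "X y = X x \<longleftrightarrow> y \<in> q" if y: "y \<in> space M" for y
    proof -
      have "y \<in> q' \<longleftrightarrow> x \<in> q'" if "y \<in> q" "q' \<in> Q" for q'
      proof -
        have "q' = q \<or> q' \<inter> q = {}"
          using Q \<open>q \<in> Q\<close> \<open>q' \<in> Q\<close> by (auto simp: partition_on_def disjoint_def)
        with \<open>x \<in> q\<close> \<open>y \<in> q\<close> show ?thesis by blast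
      qed
      then show ?thesis using X[OF y sp] \<open>q \<in> Q\<close> \<open>x \<in> q\<close> by blast
    qed
    moreover have "q \<subseteq> space M" using that Q by (auto simp: partition_on_def)
    ultimately show ?thesis by auto
  qed
  have "Q = ?f ` X ` space M"
  proof (intro equalityI subsetI)
    fix q assume "q \<in> Q"
    moreover from this have "q \<noteq> {}" using Q by (auto simp: partition_on_def)
    then obtain x where "x \<in> q" by blast
    ultimately show "q \<in> ?f ` X ` space M"
      using fib[of q x] Q by (auto simp: partition_on_def)
  next
    fix q assume "q \<in> ?f ` X ` space M"
    then obtain x where x: "x \<in> space M" "q = ?f (X x)" by auto
    then obtain q' where "q' \<in> Q" "x \<in> q'" using Q by (auto simp: partition_on_def)
    then show "q \<in> Q" using fib x by auto
  qed
  moreover have "inj_on ?f (X ` space M)" by (rule inj_onI) blast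
  ultimately show ?thesis
    unfolding partition_entropy_def obs_entropy_def
    by (simp add: sum.reindex)
qed

text \<open>For a partition this is the singleton of the block of \<open>x\<close>. Collecting all
  members containing \<open>x\<close> works for any family of sets and avoids choosing a
  block.\<close>

definition partition_label :: "'b set set \<Rightarrow> 'b \<Rightarrow> 'b set set" where
  "partition_label P x = {p \<in> P. x \<in> p}"

lemma partition_label_eq_iff: "partition_label P x = partition_label P y \<longleftrightarrow> (\<forall>p\<in>P. x \<in> p \<longleftrightarrow> y \<in> p)"
  unfolding partition_label_def by blast

lemma simple_function_finite_range:
  fixes X :: "'b \<Rightarrow> 'c::finite"
  assumes "X \<in> M \<rightarrow>\<^sub>M count_space UNIV"
  shows "simple_function M X"
  unfolding simple_function_def using measurable_sets[OF assms] by simp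

lemma simple_function_mem: "D \<in> sets M \<Longrightarrow> simple_function M (\<lambda>x. x \<in> D)"
  by (rule simple_function_finite_range) simp

lemma simple_function_partition_label:
  assumes "finite P" "P \<subseteq> sets M"
  shows "simple_function M (partition_label P)"
proof -
  have "partition_label P = (\<lambda>f. {p \<in> P. f p}) \<circ> joint P (\<lambda>p x. x \<in> p)"
    by (auto simp: fun_eq_iff partition_label_def joint_def)
  moreover have "simple_function M (joint P (\<lambda>p x. x \<in> p))"
    using assms by (intro simple_function_joint simple_function_mem) auto
  ultimately show ?thesis by (simp add: simple_function_compose)
qed

lemma partition_on_preimage_partition:
  assumes P: "partition_on (space M) P" and S: "\<And>x. x \<in> space M \<Longrightarrow> S x \<in> space M"
  shows "partition_on (space M) (preimage_partition M S P)"
proof -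
  have "x \<in> \<Union> (preimage_partition M S P)" if x: "x \<in> space M" for x
  proof -
    obtain p where "p \<in> P" "S x \<in> p" using P S[OF x] by (auto simp: partition_on_def)
    with x show ?thesis unfolding preimage_partition_def by blast
  qed
  moreover have "disjoint (preimage_partition M S P)"
    using P unfolding partition_on_def disjoint_def preimage_partition_def by blast
  ultimately show ?thesis
    unfolding partition_on_def by (auto simp: preimage_partition_def)
qed

lemma preimage_partition_same_blocks:
  assumes "x \<in> space M" "y \<in> space M"
  shows "(\<forall>q\<in>preimage_partition M S P. x \<in> q \<longleftrightarrow> y \<in> q) \<longleftrightarrow> (\<forall>p\<in>P. S x \<in> p \<longleftrightarrow> S y \<in> p)"
proof -
  have "x \<in> S -` p \<inter> space M \<longleftrightarrow> S x \<in> p" "y \<in> S -` p \<inter> space M \<longleftrightarrow> S y \<in> p" for p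
    using assms by auto
  then have "(\<forall>p\<in>P. S x \<in> p \<longleftrightarrow> S y \<in> p)
      \<longleftrightarrow> (\<forall>q\<in>(\<lambda>p. S -` p \<inter> space M) ` P. x \<in> q \<longleftrightarrow> y \<in> q)" by simp
  also have "\<dots> \<longleftrightarrow> (\<forall>q\<in>preimage_partition M S P. x \<in> q \<longleftrightarrow> y \<in> q)"
  proof -
    \<comment> \<open>The empty block separates no two points, so discarding it changes
      nothing.\<close>
    have *: "(\<forall>q\<in>A. R q) \<longleftrightarrow> (\<forall>q\<in>A - {{}}. R q)" if "R {}" for A :: "'a set set" and R
      using that by auto
    show ?thesis unfolding preimage_partition_def by (rule *) simp
  qed
  finally show ?thesis by (rule sym)
qed

text \<open>Blocks of the refinement are intersections of one block from each partition, and they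
  cover \<open>A\<close>. Points in a common intersection share a block of every partition, and
  disjointness rules out the remaining blocks.\<close>

lemma common_refinement_same_blocks:
  assumes P: "\<And>P. P \<in> \<P> \<Longrightarrow> partition_on A P" and ne: "\<P> \<noteq> {}" and x: "x \<in> A"
  shows "(\<forall>q\<in>common_refinement \<P>. x \<in> q \<longleftrightarrow> y \<in> q) \<longleftrightarrow> (\<forall>P\<in>\<P>. \<forall>p\<in>P. x \<in> p \<longleftrightarrow> y \<in> p)"
proof
  assume *: "\<forall>q\<in>common_refinement \<P>. x \<in> q \<longleftrightarrow> y \<in> q"
  have "\<Union> (common_refinement \<P>) = A"
    using partition_on_common_refinement[OF P ne] by (simp add: partition_on_def)
  then obtain q where q: "q \<in> common_refinement \<P>" "x \<in> q" "y \<in> q"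
    using x * by blast
  show "\<forall>P\<in>\<P>. \<forall>p\<in>P. x \<in> p \<longleftrightarrow> y \<in> p"
  proof (intro ballI)
    fix P p assume Pp: "P \<in> \<P>" "p \<in> P"
    obtain R where R: "R \<in> P" "x \<in> R" "y \<in> R"
      using common_refinement_exists[OF q(1) Pp(1)] q by blast
    have "p = R \<or> p \<inter> R = {}"
      using P[OF Pp(1)] Pp(2) R(1) by (auto simp: partition_on_def disjoint_def)
    with R show "x \<in> p \<longleftrightarrow> y \<in> p" by blast
  qed
next
  assume *: "\<forall>P\<in>\<P>. \<forall>p\<in>P. x \<in> p \<longleftrightarrow> y \<in> p"
  show "\<forall>q\<in>common_refinement \<P>. x \<in> q \<longleftrightarrow> y \<in> q"
  proof
    fix q assume "q \<in> common_refinement \<P>"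
    then obtain f where f: "\<And>P. P \<in> \<P> \<Longrightarrow> f P \<in> P" "q = \<Inter> (f ` \<P>)"
      unfolding common_refinement by (auto simp: Pi_iff)
    then have "x \<in> f P \<longleftrightarrow> y \<in> f P" if "P \<in> \<P>" for P
      using * that by blast
    then show "x \<in> q \<longleftrightarrow> y \<in> q" unfolding f(2) by blast
  qed
qed

lemma partition_entropy_iterated:
  assumes T: "measure_preserving M T" and P: "partition_on (space M) P" and n: "n \<noteq> 0"
  shows "partition_entropy M (iterated_partition M T P n) = obs_entropy M (itinerary T (partition_label P) n)"
proof (rule partition_entropy_eq_obs_entropy)
  let ?\<P> = "(\<lambda>k. preimage_partition M (T ^^ k) P) ` {..<n}"
  have Tk: "(T ^^ k) x \<in> space M" if "x \<in> space M" for k x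
    using measure_preserving_funpow[OF T, of k] that by (auto simp: measure_preserving_def measurable_space)
  have part: "partition_on (space M) R" if "R \<in> ?\<P>" for R
    using that P Tk by (auto intro!: partition_on_preimage_partition)
  \<comment> \<open>This is where \<open>n \<noteq> 0\<close> enters: the join of partitions is
    taken over a nonempty family.\<close>
  have ne: "?\<P> \<noteq> {}" using n by auto
  show "partition_on (space M) (iterated_partition M T P n)"
    unfolding iterated_partition_def by (rule partition_on_common_refinement[OF part ne])
  fix x y assume xy: "x \<in> space M" "y \<in> space M"
  show "itinerary T (partition_label P) n x = itinerary T (partition_label P) n y
      \<longleftrightarrow> (\<forall>q\<in>iterated_partition M T P n. x \<in> q \<longleftrightarrow> y \<in> q)"
  proof -
    have "(\<forall>q\<in>common_refinement ?\<P>. x \<in> q \<longleftrightarrow> y \<in> q) \<longleftrightarrow> (\<forall>R\<in>?\<P>. \<forall>q\<in>R. x \<in> q \<longleftrightarrow> y \<in> q)"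
      using part ne xy(1) by (rule common_refinement_same_blocks)
    then show ?thesis
      unfolding iterated_partition_def
      by (simp add: preimage_partition_same_blocks[OF xy] itinerary_eq_iff partition_label_eq_iff)
        (simp only: lessThan_iff Ball_def)
  qed
qed

lemma (in prob_space) entropy_wrt_partition_tendsto:
  assumes T: "measure_preserving M T" and P: "finite_measurable_partition M P"
  shows "(\<lambda>n. obs_entropy M (itinerary T (partition_label P) n) / real n) \<longlonglongrightarrow> entropy_wrt_partition M T P"
proof -
  let ?a = "\<lambda>n. obs_entropy M (itinerary T (partition_label P) n) / real n"
  have "simple_function M (partition_label P)"
    using P by (intro simple_function_partition_label) (auto simp: finite_measurable_partition_def)
  then obtain L where L: "?a \<longlonglongrightarrow> L"
    using convergent_obs_entropy_itinerary[OF T] by (auto simp: convergent_def)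
  have "?a n = partition_entropy M (iterated_partition M T P n) / real n" for n
    \<comment> \<open>At \<open>n = 0\<close> both quotients are 0 by the convention for
      division.\<close>
    using partition_entropy_iterated[OF T, of P n] P by (cases "n = 0") (auto simp: finite_measurable_partition_def)
  then have "?a = (\<lambda>n. partition_entropy M (iterated_partition M T P n) / real n)" by blast
  then have "entropy_wrt_partition M T P = L"
    using limI[OF L] unfolding entropy_wrt_partition_def by simp
  with L show ?thesis by simp
qed

section \<open>Cylinder approximation\<close>

text \<open>For finite \<open>J\<close> these are the cylinder sets based on
  \<open>J\<close>.\<close>

definition determined_by :: "int set \<Rightarrow> (int \<Rightarrow> 'a) set \<Rightarrow> bool" where
  "determined_by J C \<longleftrightarrow> (\<forall>x y. (\<forall>i\<in>J. x i = y i) \<longrightarrow> (x \<in> C \<longleftrightarrow> y \<in> C))"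

lemma determined_by_mono: "determined_by J C \<Longrightarrow> J \<subseteq> K \<Longrightarrow> determined_by K C"
  unfolding determined_by_def by (meson subsetD)

lemma space_config_space: "space config_space = UNIV"
  by (simp add: config_space_def space_PiM)

text \<open>Sets that can be approximated to every precision include the generators and are closed
  under complements and countable unions. The tolerance is generalised in the induction because the
  union step needs a smaller one for its members.\<close>

lemma cylinder_approximation:
  fixes \<mu> :: "(int \<Rightarrow> 'a::finite) measure"
  assumes "prob_space \<mu>" and sets: "sets \<mu> = sets config_space" and B: "B \<in> sets \<mu>" and e: "e > 0"
  shows "\<exists>J C. finite J \<and> C \<in> sets \<mu> \<and> determined_by J C \<and> measure \<mu> (sym_diff B C) < e"
proof -
  interpret prob_space \<mu> by fact
  have sp: "space \<mu> = UNIV" using sets_eq_imp_space_eq[OF sets] by (simp add: space_config_space)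
  let ?G = "{{f \<in> \<Pi>\<^sub>E i\<in>UNIV. space (count_space UNIV). f i \<in> A} | i A.
    i \<in> UNIV \<and> A \<in> sets (count_space UNIV)} :: (int \<Rightarrow> 'a) set set"
  have gen: "sets \<mu> = sigma_sets UNIV ?G"
    unfolding sets config_space_def sets_PiM_single by simp
  have "B \<in> sigma_sets UNIV ?G" using B gen by simp
  then show ?thesis using e
  proof (induction arbitrary: e rule: sigma_sets.induct)
    case (Basic C)
    then obtain i A where C: "C = {f. f i \<in> A}" by auto
    have "C \<in> sets \<mu>" using Basic gen by auto
    moreover have "determined_by {i} C" by (auto simp: C determined_by_def)
    ultimately show ?case using Basic by (intro exI[of _ "{i}"] exI[of _ C]) auto
  next
    case Empty
    then show ?case by (intro exI[of _ "{}"] exI[of _ "{}"]) (auto simp: determined_by_def)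
  next
    case (Compl B)
    then obtain J C where JC: "finite J" "C \<in> sets \<mu>" "determined_by J C" "measure \<mu> (sym_diff B C) < e"
      by blast
    have "sym_diff (UNIV - B) (UNIV - C) = sym_diff B C" by auto
    moreover have "UNIV - C \<in> sets \<mu>" using sets.compl_sets[OF JC(2)] sp by simp
    moreover have "determined_by J (UNIV - C)" using JC(3) by (auto simp: determined_by_def)
    ultimately show ?case using JC by (intro exI[of _ J] exI[of _ "UNIV - C"]) auto
  next
    case (Union B)
    have Bs: "B n \<in> sets \<mu>" for n using Union.hyps gen by simp
    \<comment> \<open>Continuity from below truncates the union at a cost of \<open>e / 2\<close>; a
      finite union keeps the set of coordinates finite.\<close>
    have "(\<lambda>N. measure \<mu> (\<Union>n<N. B n)) \<longlonglongrightarrow> measure \<mu> (\<Union>N. \<Union>n<N. B n)"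
      using Bs by (intro finite_Lim_measure_incseq monoI UN_mono) auto
    moreover have "(\<Union>N. \<Union>n<N. B n) = (\<Union>n. B n)" by auto
    ultimately have "eventually (\<lambda>N. measure \<mu> (\<Union>n. B n) - e / 2 < measure \<mu> (\<Union>n<N. B n)) sequentially"
      using Union.prems by (intro order_tendstoD(1)[of _ "measure \<mu> (\<Union>n. B n)"]) auto
    then obtain N where N: "measure \<mu> (\<Union>n. B n) - e / 2 < measure \<mu> (\<Union>n<N. B n)"
      by (auto simp: eventually_sequentially)
    \<comment> \<open>\<open>N\<close> errors of size \<open>d\<close> add up to at most
      \<open>e / 2\<close>; the \<open>+ 1\<close> keeps the denominator positive when
      \<open>N = 0\<close>.\<close>
    define d where "d = e / (2 * (real N + 1))"
    have "d > 0" using Union.prems by (simp add: d_def)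
    then have "\<exists>J C. finite J \<and> C \<in> sets \<mu> \<and> determined_by J C \<and> measure \<mu> (sym_diff (B n) C) < d" for n
      using Union.IH by blast
    then obtain J C where JC: "\<And>n. finite (J n)" "\<And>n. C n \<in> sets \<mu>" "\<And>n. determined_by (J n) (C n)"
        "\<And>n. measure \<mu> (sym_diff (B n) (C n)) < d"
      by metis
    let ?J = "\<Union>n<N. J n" and ?C = "\<Union>n<N. C n" and ?U = "\<Union>n<N. B n"
    have det: "determined_by ?J ?C"
    proof -
      have "determined_by ?J (C n)" if "n < N" for n
        using JC(3)[of n] by (rule determined_by_mono) (use that in auto)
      then show ?thesis unfolding determined_by_def by blast
    qed
    have "sym_diff (\<Union>n. B n) ?C \<subseteq> ((\<Union>n. B n) - ?U) \<union> (\<Union>n<N. sym_diff (B n) (C n))" by blast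
    then have "measure \<mu> (sym_diff (\<Union>n. B n) ?C)
        \<le> measure \<mu> (((\<Union>n. B n) - ?U) \<union> (\<Union>n<N. sym_diff (B n) (C n)))"
      using Bs JC(2) by (intro finite_measure_mono) auto
    also have "\<dots> \<le> measure \<mu> ((\<Union>n. B n) - ?U) + measure \<mu> (\<Union>n<N. sym_diff (B n) (C n))"
      using Bs JC(2) by (intro measure_Un_le) auto
    also have "measure \<mu> ((\<Union>n. B n) - ?U) = measure \<mu> (\<Union>n. B n) - measure \<mu> ?U"
      using Bs by (intro finite_measure_Diff) auto
    also have "measure \<mu> (\<Union>n<N. sym_diff (B n) (C n)) \<le> (\<Sum>n<N. measure \<mu> (sym_diff (B n) (C n)))"
      using Bs JC(2) by (intro finite_measure_subadditive_finite) auto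
    also have "\<dots> \<le> (\<Sum>n<N. d)" using JC(4) by (intro sum_mono) (simp add: less_imp_le)
    also have "\<dots> \<le> e / 2"
      using Union.prems by (simp add: d_def field_simps)
    finally have "measure \<mu> (sym_diff (\<Union>n. B n) ?C) < e" using N by simp
    then show ?case
      using det JC(1,2) by (intro exI[of _ ?J] exI[of _ ?C]) auto
  qed
qed

section \<open>Cellular automata\<close>

definition window :: "int set \<Rightarrow> (int \<Rightarrow> 'a) \<Rightarrow> int \<Rightarrow> 'a" where
  "window J = joint J (\<lambda>i x. x i)"

lemma window_eq_iff: "window J x = window J y \<longleftrightarrow> (\<forall>i\<in>J. x i = y i)"
  by (simp add: window_def joint_eq_iff)

lemma simple_function_window:
  fixes \<mu> :: "(int \<Rightarrow> 'a::finite) measure"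
  assumes "sets \<mu> = sets config_space" "finite J"
  shows "simple_function \<mu> (window J)"
  unfolding window_def
proof (rule simple_function_joint[OF assms(2)])
  fix i
  have "(\<lambda>x. x i) \<in> config_space \<rightarrow>\<^sub>M (count_space UNIV :: 'a measure)"
    unfolding config_space_def by measurable
  then have "(\<lambda>x. x i) \<in> \<mu> \<rightarrow>\<^sub>M (count_space UNIV :: 'a measure)"
    using measurable_cong_sets[OF assms(1) refl] by blast
  then show "simple_function \<mu> (\<lambda>x. x i)"
    by (rule simple_function_finite_range)
qed

lemma config_shift_funpow: "(config_shift ^^ k) x i = x (i + int k)"
  by (induction k arbitrary: i) (auto simp: config_shift_def algebra_simps)

text \<open>The cone of dependence: the outermost application of \<open>F\<close> reads cells within
  \<open>r\<close> of \<open>i\<close>, and each of those depends on cells at most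
  \<open>r * k\<close> further away.\<close>

lemma cellular_automaton_funpow_local:
  assumes "cellular_automaton r F" "\<And>j. \<bar>j - i\<bar> \<le> int (r * k) \<Longrightarrow> x j = y j"
  shows "(F ^^ k) x i = (F ^^ k) y i"
  using assms(2)
proof (induction k arbitrary: i)
  case (Suc k)
  obtain f where f: "\<And>x i. F x i = f (map x [i - int r..i + int r])"
    using assms(1) unfolding cellular_automaton_def by auto
  have "(F ^^ k) x j = (F ^^ k) y j" if "j \<in> {i - int r..i + int r}" for j
    using that by (intro Suc.IH Suc.prems) (auto simp: algebra_simps)
  then have "map ((F ^^ k) x) [i - int r..i + int r] = map ((F ^^ k) y) [i - int r..i + int r]"
    by auto
  then show ?case by (simp only: funpow.simps comp_apply f[of "(F ^^ k) x"] f[of "(F ^^ k) y"])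
qed auto

section \<open>Windows and words of letters\<close>

definition letter_partition :: "(int \<Rightarrow> 'a::finite) set set" where
  "letter_partition = range (\<lambda>a. {x. x 0 = a})"

lemma letter_partition_label_eq_iff:
  "partition_label letter_partition x = partition_label letter_partition y \<longleftrightarrow> x 0 = y 0"
  by (auto simp: partition_label_eq_iff letter_partition_def)

lemma finite_measurable_letter_partition:
  fixes \<mu> :: "(int \<Rightarrow> 'a::finite) measure"
  assumes sets: "sets \<mu> = sets config_space"
  shows "finite_measurable_partition \<mu> letter_partition"
proof -
  have sp: "space \<mu> = UNIV" using sets_eq_imp_space_eq[OF sets] by (simp add: space_config_space)
  have "{x \<in> space config_space. x 0 = a} \<in> sets config_space" for a :: 'a
    unfolding config_space_def by measurable
  then have "letter_partition \<subseteq> sets \<mu>"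
    unfolding sets by (auto simp: letter_partition_def space_config_space)
  moreover have "partition_on UNIV (letter_partition :: (int \<Rightarrow> 'a) set set)"
    unfolding partition_on_def disjoint_def letter_partition_def by auto
  ultimately show ?thesis
    unfolding finite_measurable_partition_def sp by (simp add: letter_partition_def)
qed

text \<open>Composing with the \<open>m\<close>-th power of the shift moves the window to
  \<open>[0, 2 * m]\<close>, whose \<open>2 * m + 1\<close> letters are precisely what the itinerary
  records.\<close>

lemma obs_entropy_window_le:
  fixes \<mu> :: "(int \<Rightarrow> 'a::finite) measure"
  assumes "prob_space \<mu>" and sets: "sets \<mu> = sets config_space" and S: "measure_preserving \<mu> config_shift"
  shows "obs_entropy \<mu> (window {- int m..int m})
    \<le> obs_entropy \<mu> (itinerary config_shift (partition_label letter_partition) (2 * m + 1))"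
proof -
  interpret prob_space \<mu> by fact
  let ?W = "window {- int m..int m} :: (int \<Rightarrow> 'a) \<Rightarrow> _"
  have sf: "simple_function \<mu> ?W" using sets by (rule simple_function_window) auto
  have lab: "simple_function \<mu> (partition_label letter_partition)"
    using finite_measurable_letter_partition[OF sets]
    by (intro simple_function_partition_label) (auto simp: finite_measurable_partition_def)
  have "obs_entropy \<mu> ?W = obs_entropy \<mu> (?W \<circ> config_shift ^^ m)"
    by (rule obs_entropy_comp_preserving[OF measure_preserving_funpow[OF S] sf, symmetric])
  also have "\<dots> \<le> obs_entropy \<mu> (itinerary config_shift (partition_label letter_partition) (2 * m + 1))"
  proof (rule obs_entropy_mono[OF simple_function_itinerary[OF S lab]])
    fix x y :: "int \<Rightarrow> 'a"
    assume "itinerary config_shift (partition_label letter_partition) (2 * m + 1) x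
      = itinerary config_shift (partition_label letter_partition) (2 * m + 1) y"
    then have *: "x (int k) = y (int k)" if "k < 2 * m + 1" for k
      using that by (auto simp: itinerary_eq_iff letter_partition_label_eq_iff config_shift_funpow)
    have "x (i + int m) = y (i + int m)" if "i \<in> {- int m..int m}" for i
      using that *[of "nat (i + int m)"] by auto
    then show "(?W \<circ> config_shift ^^ m) x = (?W \<circ> config_shift ^^ m) y"
      by (simp add: window_eq_iff config_shift_funpow)
  qed
  finally show ?thesis .
qed

text \<open>The order of quantifiers matters: \<open>m\<close> depends on \<open>P\<close> and
  \<open>e\<close>, and then serves every \<open>n\<close>.\<close>

lemma obs_entropy_itinerary_cellular_automaton:
  fixes \<mu> :: "(int \<Rightarrow> 'a::finite) measure"
  assumes "prob_space \<mu>" and sets: "sets \<mu> = sets config_space"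
    and ca: "cellular_automaton r F" and F: "measure_preserving \<mu> F"
    and P: "finite P" "P \<subseteq> sets \<mu>" and e: "e > 0"
  obtains m where "\<And>n. obs_entropy \<mu> (itinerary F (partition_label P) n)
    \<le> obs_entropy \<mu> (window {- int (m + r * n)..int (m + r * n)}) + real n * e"
proof -
  interpret prob_space \<mu> by fact
  \<comment> \<open>The budget \<open>e\<close> per time step is shared among the blocks; the
    \<open>+ 1\<close> covers an empty \<open>P\<close>.\<close>
  have "e / (real (card P) + 1) > 0" using e by simp
  then obtain d where d: "d > 0"
      "\<And>D. D \<in> sets \<mu> \<Longrightarrow> measure \<mu> D < d \<Longrightarrow> obs_entropy \<mu> (\<lambda>x. x \<in> D) \<le> e / (real (card P) + 1)"
    using obs_entropy_indicator_small by metis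
  have "\<forall>p\<in>P. \<exists>J C. finite J \<and> C \<in> sets \<mu> \<and> determined_by J C \<and> measure \<mu> (sym_diff p C) < d"
    using cylinder_approximation[OF assms(1) sets _ d(1)] P by blast
  then obtain J C where JC: "\<And>p. p \<in> P \<Longrightarrow> finite (J p)" "\<And>p. p \<in> P \<Longrightarrow> C p \<in> sets \<mu>"
      "\<And>p. p \<in> P \<Longrightarrow> determined_by (J p) (C p)" "\<And>p. p \<in> P \<Longrightarrow> measure \<mu> (sym_diff p (C p)) < d"
    by metis
  define D where "D p = sym_diff p (C p)" for p
  have Ds: "D p \<in> sets \<mu>" if "p \<in> P" for p using JC(2)[OF that] P that by (auto simp: D_def)
  have DH: "obs_entropy \<mu> (\<lambda>x. x \<in> D p) \<le> e / (real (card P) + 1)" if "p \<in> P" for p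
    using d(2)[OF Ds[OF that]] JC(4)[OF that] by (simp add: D_def)
  have "finite (\<Union>p\<in>P. J p)" using P JC by auto
  then obtain m where m: "(\<Union>p\<in>P. J p) \<subseteq> {- int m..int m}"
  proof -
    assume fin: "finite (\<Union>p\<in>P. J p)" and th: "\<And>m. (\<Union>p\<in>P. J p) \<subseteq> {- int m..int m} \<Longrightarrow> thesis"
    \<comment> \<open>The sum of all absolute values is a convenient bound for each of them, also
      when there are no coordinates.\<close>
    have "nat \<bar>i\<bar> \<le> (\<Sum>i\<in>(\<Union>p\<in>P. J p). nat \<bar>i\<bar>)" if "i \<in> (\<Union>p\<in>P. J p)" for i
      using fin that by (intro member_le_sum) auto
    then show thesis by (intro th[of "\<Sum>i\<in>(\<Union>p\<in>P. J p). nat \<bar>i\<bar>"]) (force simp: abs_le_iff nat_le_iff)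
  qed
  show ?thesis
  proof (rule that[of m])
    fix n
    let ?W = "window {- int (m + r * n)..int (m + r * n)} :: (int \<Rightarrow> 'a) \<Rightarrow> _"
    let ?I = "{..<n} \<times> P"
    let ?E = "\<lambda>kp. (\<lambda>x. x \<in> D (snd kp)) \<circ> F ^^ fst kp"
    have sfW: "simple_function \<mu> ?W" using sets by (rule simple_function_window) auto
    have sfE: "simple_function \<mu> (?E kp)" if "kp \<in> ?I" for kp
      using that Ds by (intro simple_function_comp_preserving measure_preserving_funpow[OF F] simple_function_mem) auto
    have sfJ: "simple_function \<mu> (joint ?I ?E)"
      using P sfE by (intro simple_function_joint) auto
    have "obs_entropy \<mu> (itinerary F (partition_label P) n) \<le> obs_entropy \<mu> (\<lambda>x. (?W x, joint ?I ?E x))"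
    proof (rule obs_entropy_mono[OF simple_function_Pair[OF sfW sfJ]])
      fix x y assume eq: "(?W x, joint ?I ?E x) = (?W y, joint ?I ?E y)"
      have w: "x j = y j" if "j \<in> {- int (m + r * n)..int (m + r * n)}" for j
        using eq that by (auto simp: window_eq_iff)
      have Deq: "(F ^^ k) x \<in> D p \<longleftrightarrow> (F ^^ k) y \<in> D p" if "k < n" "p \<in> P" for k p
        using eq that by (auto simp: joint_eq_iff)
      \<comment> \<open>The cylinder looks at \<open>(F ^^ k) x\<close> on \<open>[-m, m]\<close>
        only, and for \<open>k < n\<close> the cone of dependence of these cells stays inside the
        window.\<close>
      have Ceq: "(F ^^ k) x \<in> C p \<longleftrightarrow> (F ^^ k) y \<in> C p" if "k < n" "p \<in> P" for k p
      proof -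
        have "(F ^^ k) x i = (F ^^ k) y i" if i: "i \<in> J p" for i
        proof (rule cellular_automaton_funpow_local[OF ca])
          fix j assume "\<bar>j - i\<bar> \<le> int (r * k)"
          moreover have "r * k \<le> r * n" using \<open>k < n\<close> by simp
          then have "int (r * k) \<le> int (r * n)" by (simp only: of_nat_le_iff)
          moreover have "i \<in> {- int m..int m}" using m i \<open>p \<in> P\<close> by auto
          ultimately show "x j = y j" by (intro w) auto
        qed
        then show ?thesis using JC(3)[OF \<open>p \<in> P\<close>] by (auto simp: determined_by_def)
      qed
      \<comment> \<open>Membership in \<open>p\<close> is the exclusive or of membership in
        \<open>C p\<close> and in the error set \<open>D p\<close>.\<close>
      have "(F ^^ k) x \<in> p \<longleftrightarrow> (F ^^ k) y \<in> p" if "k < n" "p \<in> P" for k p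
        using Deq[OF that] Ceq[OF that] by (auto simp: D_def)
      then show "itinerary F (partition_label P) n x = itinerary F (partition_label P) n y"
        by (simp add: itinerary_eq_iff partition_label_eq_iff)
    qed
    also have "\<dots> \<le> obs_entropy \<mu> ?W + obs_entropy \<mu> (joint ?I ?E)"
      by (rule obs_entropy_Pair[OF sfW sfJ])
    also have "obs_entropy \<mu> (joint ?I ?E) \<le> (\<Sum>kp\<in>?I. obs_entropy \<mu> (?E kp))"
      using P sfE by (intro obs_entropy_joint) auto
    also have "\<dots> \<le> (\<Sum>kp\<in>?I. e / (real (card P) + 1))"
    proof (rule sum_mono)
      fix kp assume "kp \<in> ?I"
      then have p: "snd kp \<in> P" by auto
      \<comment> \<open>By invariance under \<open>F\<close> the error bit at time \<open>k\<close>
        has the entropy of the bit at time 0.\<close>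
      show "obs_entropy \<mu> (?E kp) \<le> e / (real (card P) + 1)"
        using obs_entropy_comp_preserving[OF measure_preserving_funpow[OF F] simple_function_mem[OF Ds[OF p]]] DH[OF p]
        by simp
    qed
    also have "\<dots> = real n * (real (card P) * e / (real (card P) + 1))"
      by (simp add: card_cartesian_product)
    also have "\<dots> \<le> real n * e"
      using e by (intro mult_left_mono) (auto simp: field_simps)
    finally show "obs_entropy \<mu> (itinerary F (partition_label P) n) \<le> obs_entropy \<mu> ?W + real n * e"
      by simp
  qed
qed

lemma entropy_wrt_partition_cellular_automaton_le:
  fixes \<mu> :: "(int \<Rightarrow> 'a::finite) measure"
  assumes "prob_space \<mu>" and sets: "sets \<mu> = sets config_space"
    and ca: "cellular_automaton r F" and F: "measure_preserving \<mu> F"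
    and S: "measure_preserving \<mu> config_shift" and P: "finite_measurable_partition \<mu> P"
  shows "entropy_wrt_partition \<mu> F P \<le> 2 * real r * entropy_wrt_partition \<mu> config_shift letter_partition"
proof (rule field_le_epsilon)
  interpret prob_space \<mu> by fact
  fix e :: real assume "e > 0"
  define w where "w L = obs_entropy \<mu> (itinerary config_shift (partition_label letter_partition) L)" for L
  define h where "h = entropy_wrt_partition \<mu> config_shift letter_partition"
  have w: "(\<lambda>L. w L / real L) \<longlonglongrightarrow> h"
    unfolding w_def h_def
    by (rule entropy_wrt_partition_tendsto[OF S finite_measurable_letter_partition[OF sets]])
  obtain m where m: "\<And>n. obs_entropy \<mu> (itinerary F (partition_label P) n)
      \<le> obs_entropy \<mu> (window {- int (m + r * n)..int (m + r * n)}) + real n * e"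
    using obs_entropy_itinerary_cellular_automaton[OF assms(1) sets ca F _ _ \<open>e > 0\<close>, of P] P
    unfolding finite_measurable_partition_def by metis
  let ?L = "\<lambda>n. 2 * (m + r * n) + 1"
  have lim: "(\<lambda>n. w (?L n) / real n) \<longlonglongrightarrow> 2 * real r * h"
  \<comment> \<open>For \<open>r = 0\<close> the word length \<open>?L n\<close> stays constant, so
    it cannot be substituted into the limit \<open>w\<close>; the bounded numerator over
    \<open>n\<close> then tends to 0 directly. For \<open>r > 0\<close> it grows at least like
    \<open>n\<close>.\<close>
  proof (cases "r = 0")
    case True
    then show ?thesis by (simp add: lim_const_over_n)
  next
    case False
    have "n \<le> ?L n" for n using False by (cases r) auto
    then have "filterlim ?L at_top sequentially"
      by (intro filterlim_at_top_mono[OF filterlim_ident]) auto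
    then have "(\<lambda>n. w (?L n) / real (?L n)) \<longlonglongrightarrow> h"
      by (rule filterlim_compose[OF w])
    moreover have "(\<lambda>n. real (?L n) / real n) \<longlonglongrightarrow> 2 * real r"
      by simp real_asymp
    ultimately have "(\<lambda>n. w (?L n) / real (?L n) * (real (?L n) / real n)) \<longlonglongrightarrow> h * (2 * real r)"
      by (rule tendsto_mult)
    moreover have "w (?L n) / real (?L n) * (real (?L n) / real n) = w (?L n) / real n" for n
      by (subst times_divide_times_eq) (simp del: of_nat_add of_nat_Suc of_nat_mult)
    ultimately show ?thesis by (simp only: mult.commute)
  qed
  have "(\<lambda>n. w (?L n) / real n + e) \<longlonglongrightarrow> 2 * real r * h + e"
    by (intro tendsto_intros lim)
  with entropy_wrt_partition_tendsto[OF F P]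
  show "entropy_wrt_partition \<mu> F P \<le> 2 * real r * entropy_wrt_partition \<mu> config_shift letter_partition + e"
    unfolding h_def[symmetric]
  proof (rule LIMSEQ_le)
    have "obs_entropy \<mu> (itinerary F (partition_label P) n) / real n \<le> w (?L n) / real n + e" if "n \<ge> 1" for n
    proof -
      have "obs_entropy \<mu> (itinerary F (partition_label P) n) \<le> w (?L n) + real n * e"
        using m[of n] obs_entropy_window_le[OF assms(1) sets S, of "m + r * n"] by (simp add: w_def)
      then have "obs_entropy \<mu> (itinerary F (partition_label P) n) / real n \<le> (w (?L n) + real n * e) / real n"
        by (rule divide_right_mono) simp
      also have "\<dots> = w (?L n) / real n + e" using that by (simp add: add_divide_distrib)
      finally show ?thesis .
    qed
    then show "\<exists>N. \<forall>n\<ge>N. obs_entropy \<mu> (itinerary F (partition_label P) n) / real n \<le> w (?L n) / real n + e"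
      by blast
  qed
qed

theorem proposition8:
  fixes F :: "(int \<Rightarrow> 'a::finite) \<Rightarrow> int \<Rightarrow> 'a"
    and r :: nat
    and \<mu> :: "(int \<Rightarrow> 'a) measure"
  assumes "cellular_automaton r F"
    and "prob_space \<mu>"
    and "sets \<mu> = sets config_space"
    and "measure_preserving \<mu> F"
    and "measure_preserving \<mu> config_shift"
  shows "ks_entropy \<mu> F \<le> 2 * ereal (real r) * ks_entropy \<mu> config_shift"
  unfolding ks_entropy_def[of \<mu> F]
proof (rule SUP_least)
  fix P assume "P \<in> {P. finite_measurable_partition \<mu> P}"
  then have "entropy_wrt_partition \<mu> F P
      \<le> 2 * real r * entropy_wrt_partition \<mu> config_shift letter_partition"
    using assms by (intro entropy_wrt_partition_cellular_automaton_le) auto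
  then have "ereal (entropy_wrt_partition \<mu> F P)
      \<le> (2 * ereal (real r)) * ereal (entropy_wrt_partition \<mu> config_shift letter_partition)"
    by (simp add: numeral_eq_ereal)
  \<comment> \<open>The letter partition is one of the competitors in the supremum for the shift,
    and the factor is nonnegative.\<close>
  also have "\<dots> \<le> 2 * ereal (real r) * ks_entropy \<mu> config_shift"
    unfolding ks_entropy_def using finite_measurable_letter_partition[OF assms(3)]
    by (intro ereal_mult_left_mono SUP_upper) auto
  finally show "ereal (entropy_wrt_partition \<mu> F P) \<le> 2 * ereal (real r) * ks_entropy \<mu> config_shift" .
qed

end
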